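(* Let $n\ge1$. Let $A_n(t)=\sum_{\pi\in\mathfrak{S}_n}t^{\mathrm{des}(\pi)}$ be the Eulerian polynomial, where $\mathfrak{S}_n$ is the set of permutations of $[n]$ and $\mathrm{des}(\pi)=|\{i\in[n-1]:\pi_i>\pi_{i+1}\}|$. A segmented permutation of $[n]$ is a permutation $\sigma=\sigma_1\cdots\sigma_n$ of $[n]$ together with a choice, for each slot between consecutive letters $\sigma_i,\sigma_{i+1}$ ($1\le i\le n-1$), of whether a bar is placed there; let $\mathcal{SP}_n$ be the set of these. For $\sigma\in\mathcal{SP}_n$ let $\mathrm{des}(\sigma)$ be the number of $i\in[n-1]$ with $\sigma_i>\sigma_{i+1}$ and no bar between $\sigma_i$ and $\sigma_{i+1}$, and $\mathrm{seg}(\sigma)$ the number of bars. Let $\alpha_n(t,q)=\sum_{\sigma\in\mathcal{SP}_n}t^{\mathrm{des}(\sigma)}q^{\mathrm{seg}(\sigma)}$ and $P_n(t)=\sum_{\sigma\in\mathcal{SP}_n}t^{\mathrm{des}(\sigma)}$. Then $$\alpha_n(t,q)=(1+q)^{n-1}A_n\!\left(\frac{t+q}{1+q}\right)\quad\text{and}\quad P_n(t)=2^{n-1}A_n\!\left(\frac{t+1}{2}\right).$$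
   Context: The first identity is an identity of polynomials: writing $A_n(t)=\sum_{k=0}^{n-1}A(n,k)t^k$, its right-hand side means $\sum_{k=0}^{n-1}A(n,k)(t+q)^k(1+q)^{n-1-k}$. *)

theory Defs
  imports
    "HOL-Combinatorics.Permutations"
    "HOL-Computational_Algebra.Polynomial"
begin

definition des :: "nat \<Rightarrow> (nat \<Rightarrow> nat) \<Rightarrow> nat" where
  "des n \<pi> = card {i \<in> {1..n-1}. \<pi> i > \<pi> (i + 1)}"

definition eulerian_poly :: "nat \<Rightarrow> int poly" where
  "eulerian_poly n = (\<Sum>\<pi> | \<pi> permutes {1..n}. monom 1 (des n \<pi>))"

text \<open>A segmented permutation is a pair of a permutation and the set of barred slots,
  where slot \<open>i\<close> is the one between the letters \<open>\<sigma> i\<close> and \<open>\<sigma> (i + 1)\<close>.\<close>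

definition segmented_perms :: "nat \<Rightarrow> ((nat \<Rightarrow> nat) \<times> nat set) set" where
  "segmented_perms n = {\<sigma>. \<sigma> permutes {1..n}} \<times> Pow {1..n-1}"

definition sdes :: "nat \<Rightarrow> (nat \<Rightarrow> nat) \<times> nat set \<Rightarrow> nat" where
  "sdes n = (\<lambda>(\<sigma>, B). card {i \<in> {1..n-1}. \<sigma> i > \<sigma> (i + 1) \<and> i \<notin> B})"

definition seg :: "(nat \<Rightarrow> nat) \<times> nat set \<Rightarrow> nat" where
  "seg = (\<lambda>(\<sigma>, B). card B)"

text \<open>Bivariate polynomials are elements of \<open>\<int>[t][q]\<close>: the inner variable is \<open>t\<close>,
  the outer one is \<open>q\<close>.\<close>

definition var_t :: "int poly poly" where
  "var_t = [:[:0, 1:]:]"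

definition var_q :: "int poly poly" where
  "var_q = [:0, 1:]"

definition alpha_poly :: "nat \<Rightarrow> int poly poly" where
  "alpha_poly n = (\<Sum>\<sigma>\<in>segmented_perms n. var_t ^ sdes n \<sigma> * var_q ^ seg \<sigma>)"

definition P_poly :: "nat \<Rightarrow> int poly" where
  "P_poly n = (\<Sum>\<sigma>\<in>segmented_perms n. monom 1 (sdes n \<sigma>))"

end

theory Submission
  imports Defs
begin

text \<open>Fix a permutation with descent set \<open>D\<close>. Summing over all sets of bars, every slot
  contributes a factor independently of the others: \<open>t + q\<close> if it is a descent, since a bar erases
  the descent, and \<open>1 + q\<close> otherwise. Grouping the permutations by their number of descents gives
  the first identity in every commutative ring. For \<open>q = 1\<close> the sum obtained is the homogenization
  of the Eulerian polynomial at \<open>(t + 1, 2)\<close>, which is the second identity.\<close>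

lemma sum_Pow_power_card_Diff:
  fixes x y :: "'a::comm_semiring_1"
  assumes "finite I" "D \<subseteq> I"
  shows "(\<Sum>B\<in>Pow I. x ^ card (D - B) * y ^ card B) = (x + y) ^ card D * (1 + y) ^ card (I - D)"
proof -
  let ?w = "\<lambda>i. if i \<in> D then x else 1"
  have "x ^ card (D - B) * y ^ card B = (\<Prod>i\<in>B. y) * prod ?w (I - B)" for B
  proof -
    have "prod ?w (I - B) = (\<Prod>i\<in>(I - B) \<inter> D. x)"
      using assms(1) by (intro prod.inter_restrict[symmetric]) simp
    also have "(I - B) \<inter> D = D - B"
      using assms(2) by blast
    finally show ?thesis
      by (simp add: mult.commute)
  qed
  then have "(\<Sum>B\<in>Pow I. x ^ card (D - B) * y ^ card B) =
      (\<Sum>B\<in>Pow I. (\<Prod>i\<in>B. y) * prod ?w (I - B))"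
    by simp
  also have "\<dots> = (\<Prod>i\<in>I. y + ?w i)"
    using assms(1) by (rule prod_add[symmetric])
  also have "\<dots> = (\<Prod>i\<in>I - D. y + ?w i) * (\<Prod>i\<in>D. y + ?w i)"
    using assms by (intro prod.subset_diff)
  also have "\<dots> = (x + y) ^ card D * (1 + y) ^ card (I - D)"
    by (simp add: add.commute mult.commute)
  finally show ?thesis .
qed

lemma sum_coeff_mult_power_eq_poly:
  fixes p :: "'a::comm_semiring_1 poly"
  assumes "degree p \<le> m"
  shows "(\<Sum>k=0..m. coeff p k * (c * x) ^ k * c ^ (m - k)) = c ^ m * poly p x"
proof -
  have "coeff p k * (c * x) ^ k * c ^ (m - k) = c ^ m * (coeff p k * x ^ k)" if "k \<le> m" for k
  proof -
    have "c ^ m = c ^ k * c ^ (m - k)"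
      using that by (simp flip: power_add)
    then show ?thesis
      by (simp add: power_mult_distrib mult_ac)
  qed
  then have "(\<Sum>k=0..m. coeff p k * (c * x) ^ k * c ^ (m - k)) =
      c ^ m * (\<Sum>k\<le>m. coeff p k * x ^ k)"
    by (simp add: sum_distrib_left atMost_atLeast0)
  also have "(\<Sum>k\<le>m. coeff p k * x ^ k) = poly (\<Sum>k\<le>m. monom (coeff p k) k) x"
    by (simp add: poly_sum poly_monom)
  also have "(\<Sum>k\<le>m. monom (coeff p k) k) = p"
    using assms by (rule poly_as_sum_of_monoms')
  finally show ?thesis .
qed

lemma map_poly_of_int_sum_monom:
  "map_poly of_int (\<Sum>a\<in>A. monom 1 (g a)) = (\<Sum>a\<in>A. monom (1 :: 'a::ring_1) (g a))"
  by (intro poly_eqI) (simp add: coeff_map_poly coeff_sum if_distrib cong: if_cong)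

lemma pcompose_map_poly_of_int:
  fixes q :: "'a::comm_ring_1 poly"
  shows "pcompose (map_poly of_int p) q = poly (map_poly of_int p) q"
  by (simp add: pcompose_altdef map_poly_map_poly o_def flip: of_int_poly)

definition descents :: "nat \<Rightarrow> (nat \<Rightarrow> nat) \<Rightarrow> nat set" where
  "descents n \<pi> = {i \<in> {1..n-1}. \<pi> i > \<pi> (i + 1)}"

lemma descents_subset: "descents n \<pi> \<subseteq> {1..n-1}"
  by (auto simp: descents_def)

lemma des_eq_card_descents: "des n \<pi> = card (descents n \<pi>)"
  by (simp add: des_def descents_def)

lemma sdes_eq_card_descents_Diff: "sdes n (\<pi>, B) = card (descents n \<pi> - B)"
  by (auto simp: sdes_def descents_def intro: arg_cong[where f = card])

lemma des_le: "des n \<pi> \<le> n - 1"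
  using card_mono[OF _ descents_subset] by (simp add: des_eq_card_descents)

lemma card_Diff_descents: "card ({1..n-1} - descents n \<pi>) = n - 1 - des n \<pi>"
  using card_Diff_subset[OF finite_subset[OF descents_subset finite_atLeastAtMost] descents_subset]
  by (simp add: des_eq_card_descents)

lemma coeff_eulerian_poly:
  "coeff (eulerian_poly n) k = int (card {\<pi>. \<pi> permutes {1..n} \<and> des n \<pi> = k})"
  by (simp add: eulerian_poly_def coeff_sum finite_permutations sum.If_cases Collect_conj_eq)

lemma degree_eulerian_poly_le: "degree (eulerian_poly n) \<le> n - 1"
  unfolding eulerian_poly_def
  by (intro degree_sum_le) (simp_all add: finite_permutations degree_monom_eq des_le del: One_nat_def)

lemma sum_permutes_des_eq_sum_coeff_eulerian_poly:
  fixes f :: "nat \<Rightarrow> 'a::ring_1"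
  shows "(\<Sum>\<pi> | \<pi> permutes {1..n}. f (des n \<pi>)) =
    (\<Sum>k=0..n-1. of_int (coeff (eulerian_poly n) k) * f k)"
proof -
  have "(\<Sum>\<pi> | \<pi> permutes {1..n}. f (des n \<pi>)) =
      (\<Sum>k=0..n-1. \<Sum>\<pi> | \<pi> \<in> {\<pi>. \<pi> permutes {1..n}} \<and> des n \<pi> = k. f (des n \<pi>))"
    by (intro sum.group[symmetric]) (auto simp: finite_permutations des_le simp del: One_nat_def)
  also have "\<dots> = (\<Sum>k=0..n-1. of_int (coeff (eulerian_poly n) k) * f k)"
    by (simp add: coeff_eulerian_poly)
  finally show ?thesis .
qed

lemma sum_segmented_perms_eq_sum_permutes:
  fixes x y :: "'a::comm_semiring_1"
  shows "(\<Sum>\<sigma>\<in>segmented_perms n. x ^ sdes n \<sigma> * y ^ seg \<sigma>) =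
    (\<Sum>\<pi> | \<pi> permutes {1..n}. (x + y) ^ des n \<pi> * (1 + y) ^ (n - 1 - des n \<pi>))"
proof -
  have "(\<Sum>\<sigma>\<in>segmented_perms n. x ^ sdes n \<sigma> * y ^ seg \<sigma>) =
      (\<Sum>\<pi> | \<pi> permutes {1..n}. \<Sum>B\<in>Pow {1..n-1}. x ^ card (descents n \<pi> - B) * y ^ card B)"
    by (simp add: segmented_perms_def seg_def sum.cartesian_product split_def
      flip: sdes_eq_card_descents_Diff)
  also have "\<dots> =
      (\<Sum>\<pi> | \<pi> permutes {1..n}. (x + y) ^ des n \<pi> * (1 + y) ^ (n - 1 - des n \<pi>))"
    by (simp only: sum_Pow_power_card_Diff[OF finite_atLeastAtMost descents_subset]
      card_Diff_descents des_eq_card_descents[symmetric])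
  finally show ?thesis .
qed

lemma sum_segmented_perms_eq_sum_coeff_eulerian_poly:
  fixes x y :: "'a::comm_ring_1"
  shows "(\<Sum>\<sigma>\<in>segmented_perms n. x ^ sdes n \<sigma> * y ^ seg \<sigma>) =
    (\<Sum>k=0..n-1. of_int (coeff (eulerian_poly n) k) * (x + y) ^ k * (1 + y) ^ (n - 1 - k))"
  unfolding sum_segmented_perms_eq_sum_permutes
  by (subst sum_permutes_des_eq_sum_coeff_eulerian_poly) (simp add: mult.assoc)

lemma sum_segmented_perms_power_sdes:
  fixes x :: "'a::comm_ring_1"
  shows "(\<Sum>\<sigma>\<in>segmented_perms n. (2 * x - 1) ^ sdes n \<sigma>) =
    2 ^ (n - 1) * poly (map_poly of_int (eulerian_poly n)) x"
proof -
  have "(\<Sum>\<sigma>\<in>segmented_perms n. (2 * x - 1) ^ sdes n \<sigma>) =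
      (\<Sum>k=0..n-1. coeff (map_poly of_int (eulerian_poly n)) k * (2 * x) ^ k * 2 ^ (n - 1 - k))"
    using sum_segmented_perms_eq_sum_coeff_eulerian_poly[of "2 * x - 1" n 1]
    by (simp add: coeff_map_poly)
  also have "\<dots> = 2 ^ (n - 1) * poly (map_poly of_int (eulerian_poly n)) x"
    by (intro sum_coeff_mult_power_eq_poly
      order_trans[OF map_poly_degree_leq degree_eulerian_poly_le])
  finally show ?thesis .
qed

theorem theorem3p4:
  fixes n :: nat
  assumes "n \<ge> 1"
  shows "alpha_poly n =
           (\<Sum>k=0..n-1. of_int (coeff (eulerian_poly n) k) *
              (var_t + var_q) ^ k * (1 + var_q) ^ (n - 1 - k))
       \<and> map_poly rat_of_int (P_poly n) =
           smult (2 ^ (n - 1)) (pcompose (map_poly rat_of_int (eulerian_poly n)) [:1/2, 1/2:])"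
proof
  show "alpha_poly n =
           (\<Sum>k=0..n-1. of_int (coeff (eulerian_poly n) k) *
              (var_t + var_q) ^ k * (1 + var_q) ^ (n - 1 - k))"
    unfolding alpha_poly_def by (rule sum_segmented_perms_eq_sum_coeff_eulerian_poly)
next
  let ?h = "[:1/2, 1/2:] :: rat poly"
  have "monom 1 k = (2 * ?h - 1) ^ k" for k
    by (simp add: monom_altdef numeral_poly one_pCons)
  then have "map_poly rat_of_int (P_poly n) = (\<Sum>\<sigma>\<in>segmented_perms n. (2 * ?h - 1) ^ sdes n \<sigma>)"
    by (simp add: P_poly_def map_poly_of_int_sum_monom)
  also have "\<dots> = 2 ^ (n - 1) * poly (map_poly of_int (eulerian_poly n)) ?h"
    by (rule sum_segmented_perms_power_sdes)
  also have "\<dots> = smult (2 ^ (n - 1)) (pcompose (map_poly rat_of_int (eulerian_poly n)) ?h)"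
    by (simp add: pcompose_map_poly_of_int numeral_poly poly_const_pow)
  finally show "map_poly rat_of_int (P_poly n) =
      smult (2 ^ (n - 1)) (pcompose (map_poly rat_of_int (eulerian_poly n)) ?h)" .
qed

end
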